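(* For every integer $r\ge 2$ and every tree $T$ with $\ell$ leaves, \[ \left\lceil (r-1)\cdot\frac{\ell}{r}\right\rceil \le \mathcal{D}_r(T,\mathcal{T}) \le \left\lceil (r-1)\cdot\frac{\ell}{2}\right\rceil . \] In particular, for $r=2$ we have $\mathcal{D}_2(T,\mathcal{T})=\lceil \ell/2\rceil$.
   Context: All graphs are finite. A leaf of a tree is a vertex of degree $1$. Write $[r]=\{1,\dots,r\}$. $\mathcal{T}$ denotes the set of all trees. For a graph $G$ and an integer $r\ge 2$, the $r$-colour discrepancy of trees in $G$ is \[ \mathcal{D}_r(G,\mathcal{T})=\min_{f:E(G)\to[r]}\ \max_{S}\ \max_{j\in[r]}\left(r\left|f^{-1}(j)\cap E(S)\right|-|E(S)|\right), \] where the first maximum is over all subgraphs $S$ of $G$ that are trees (when $G=T$ is a tree, these are the subtrees of $T$; a single vertex counts as a tree, with empty edge set). *)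

theory Defs
  imports Complex_Main "HOL-Library.FuncSet"
begin

type_synonym 'a graph = "'a set \<times> 'a set set"

abbreviation verts :: "'a graph \<Rightarrow> 'a set" where
  "verts G \<equiv> fst G"

abbreviation edges :: "'a graph \<Rightarrow> 'a set set" where
  "edges G \<equiv> snd G"

text \<open>Finite simple undirected graphs; an edge is a two-element set of vertices.\<close>

definition graph :: "'a graph \<Rightarrow> bool" where
  "graph G \<longleftrightarrow> finite (verts G) \<and> (\<forall>e \<in> edges G. e \<subseteq> verts G \<and> card e = 2)"

definition subgraph :: "'a graph \<Rightarrow> 'a graph \<Rightarrow> bool" where
  "subgraph S G \<longleftrightarrow> graph S \<and> graph G \<and> verts S \<subseteq> verts G \<and> edges S \<subseteq> edges G"

definition degree :: "'a graph \<Rightarrow> 'a \<Rightarrow> nat" where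
  "degree G v = card {e \<in> edges G. v \<in> e}"

text \<open>A walk is given by its nonempty list of vertices.\<close>

definition walk :: "'a graph \<Rightarrow> 'a list \<Rightarrow> bool" where
  "walk G p \<longleftrightarrow> p \<noteq> [] \<and> set p \<subseteq> verts G \<and>
     (\<forall>i. Suc i < length p \<longrightarrow> {p ! i, p ! Suc i} \<in> edges G)"

text \<open>The null graph does not count as connected, hence is not a tree.\<close>

definition connected_graph :: "'a graph \<Rightarrow> bool" where
  "connected_graph G \<longleftrightarrow> verts G \<noteq> {} \<and>
     (\<forall>u \<in> verts G. \<forall>v \<in> verts G. \<exists>p. walk G p \<and> hd p = u \<and> last p = v)"

text \<open>The starting vertex of a cycle is not repeated at the end of the list.\<close>

definition cycle :: "'a graph \<Rightarrow> 'a list \<Rightarrow> bool" where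
  "cycle G p \<longleftrightarrow> walk G p \<and> distinct p \<and> 3 \<le> length p \<and> {last p, hd p} \<in> edges G"

definition trees :: "'a graph set" where
  "trees = {T. graph T \<and> connected_graph T \<and> (\<nexists>p. cycle T p)}"

definition leaves :: "'a graph \<Rightarrow> 'a set" where
  "leaves T = {v \<in> verts T. degree T v = 1}"

text \<open>
  \<open>Min\<close> and \<open>Max\<close> below range over finite sets whenever \<open>graph G\<close> holds: the colourings are
  extensional functions, and a finite graph has finitely many subgraphs.  The sets are nonempty if
  moreover \<open>r \<ge> 1\<close> and \<open>G\<close> has a subgraph in the family \<open>\<F>\<close>; for \<open>\<F> = trees\<close> any single vertex
  of \<open>G\<close> is one.
\<close>

definition discrepancy :: "nat \<Rightarrow> 'a graph \<Rightarrow> 'a graph set \<Rightarrow> int" where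
  "discrepancy r G \<F> =
     Min ((\<lambda>f. Max ((\<lambda>S. Max ((\<lambda>j. int r * int (card {e \<in> edges S. f e = j}) - int (card (edges S)))
                                  ` {1..r}))
                      ` {S \<in> \<F>. subgraph S G}))
            ` (edges G \<rightarrow>\<^sub>E {1..r}))"

end

theory Submission
  imports Defs
begin

text \<open>
  Give an edge weight \<open>r - 1\<close> for its own colour and \<open>-1\<close> for every other colour. The \<open>surplus\<close> of an
  edge set in a colour is its total weight, and the discrepancy is the minimum over all colourings of
  the maximal surplus of a subtree. The weights of one edge over all \<open>r\<close> colours sum to \<open>0\<close>.

  \<^emph>\<open>Lower bound.\<close> For each colour \<open>j\<close> cut off those leaves whose edge does not have colour \<open>j\<close>. The
  whole tree contributes \<open>0\<close> to the sum over \<open>j\<close> of the surpluses, and each of the \<open>l\<close> leaf edges is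
  cut off in \<open>r - 1\<close> of the colours, gaining \<open>1\<close> each time (\<open>sum_surplus_pruned\<close>). So the sum is
  \<open>(r - 1) * l\<close>, and some colour reaches the average (\<open>exists_large_surplus\<close>). A single edge is an
  exception, as its two leaves share one edge; there the edge itself has surplus \<open>r - 1\<close>.

  \<^emph>\<open>Upper bound.\<close> Root the tree at a leaf and colour it from the other leaves towards the root. For a
  rooted tree with \<open>m\<close> leaves apart from its root, look at the vector that lists, for each colour, the
  largest surplus of a subtree containing the root. This vector is kept below an arithmetic
  progression, assigned to the colours in some order, with difference \<open>1\<close>, length \<open>r\<close> and mean
  \<open>m * (r - 1) / 2\<close>. Three facts make this work.

  \<^item> Along a path: give a new root edge the colour that is currently lowest. Its entry rises by
    \<open>r - 1\<close> and the others drop by \<open>1\<close>, so the progression is only permuted.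

  \<^item> At a branching vertex the vectors of the two parts are added. The order of the colours may be
    chosen separately in each part, and for a suitable choice the sum of two progressions is again
    one, up to rounding. If \<open>r\<close> is odd, for instance, let the second descend half as fast as the first
    ascends, in two interleaved sweeps.

  \<^item> The largest entry is \<open>m * (r - 1) / 2 + (r - 1) / 2\<close>, which is \<open>(r - 1) * l / 2\<close> when the root
    is a leaf, as then \<open>m = l - 1\<close>.

  If \<open>r\<close> and \<open>m\<close> are even the entries of the progression are half-integers. They must be rounded, and
  rounding errors must not pile up when parts are merged. Rounding the entries up and down alternately
  achieves this: the error depends only on the parity of the position, and the merging step can control
  this parity. The definition \<open>profile\<close> covers both cases, and
  \<open>profile_merge\<close> and \<open>rooted_tree_coloring\<close> carry the argument.
\<close>

section \<open>Pairing two arithmetic progressions\<close>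

text \<open>Twice the rounding error of the entry number \<open>x\<close> of a progression.\<close>
definition wave :: "int \<Rightarrow> int \<Rightarrow> int" where
  "wave d x = (if even x then d else - d)"

lemma bij_betw_endo:
  assumes "finite I" "\<And>i. i \<in> I \<Longrightarrow> f i \<in> I" "inj_on f I"
  shows "bij_betw f I I"
  using assms by (metis bij_betw_def endo_inj_surj image_subsetI)

text \<open>
  In this and the next three lemmas \<open>i\<close> and \<open>q i\<close> are the positions of one colour in the two progressions to be
  added and \<open>k i\<close> is its position in their sum. Here \<open>q\<close> descends by \<open>1\<close> when \<open>i\<close> grows by \<open>2\<close>, in one
  sweep for the even \<open>i\<close> and another for the odd \<open>i\<close>. So the sum ascends by \<open>1\<close> in each sweep, and the
  two sweeps fill consecutive ranges.
\<close>
lemma index_merge_odd: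
  fixes s :: int
  assumes "0 \<le> s" "I = {0..<2 * s + 1}"
  shows "\<exists>q k. bij_betw q I I \<and> bij_betw k I I \<and> (\<forall>i\<in>I. i + q i = k i + s)"
proof -
  define q where "q i = (if even i then s - i div 2 else 2 * s - i div 2)" for i :: int
  define k where "k i = (if even i then i div 2 else s + 1 + i div 2)" for i :: int
  have "bij_betw q I I"
  proof (rule bij_betw_endo)
    show "inj_on q I" by (rule inj_onI) (auto simp: q_def assms(2) split: if_splits; presburger)
    show "q i \<in> I" if "i \<in> I" for i
      using that assms(1) by (auto simp: q_def assms(2) split: if_splits; presburger)
  qed (simp add: assms(2))
  moreover have "bij_betw k I I"
  proof (rule bij_betw_endo)
    show "inj_on k I" by (rule inj_onI) (auto simp: k_def assms(2) split: if_splits; presburger)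
    show "k i \<in> I" if "i \<in> I" for i
      using that assms(1) by (auto simp: k_def assms(2) split: if_splits; presburger)
  qed (simp add: assms(2))
  moreover have "\<forall>i\<in>I. i + q i = k i + s" by (auto simp: q_def k_def; presburger)
  ultimately show ?thesis by blast
qed

text \<open>
  The same sweeps for even length, where \<open>2 * (i div 2)\<close> is one of the two alternate roundings of a
  progression of half-integers. As it is even, \<open>q i\<close> and \<open>k i + s - 1\<close> have the same parity; this transfers
  a rounding of the second progression to the sum.
\<close>
lemma index_merge_plus:
  fixes s :: int
  assumes "1 \<le> s" "I = {0..<2 * s}"
  shows "\<exists>q k. bij_betw q I I \<and> bij_betw k I I \<and>
           (\<forall>i\<in>I. 2 * (i div 2) + q i = k i + s - 1)"
proof -
  define q where "q i = (if even i then s - 1 - i div 2 else 2 * s - 1 - i div 2)" for i :: int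
  define k where "k i = (if even i then i div 2 else s + i div 2)" for i :: int
  have "bij_betw q I I"
  proof (rule bij_betw_endo)
    show "inj_on q I" by (rule inj_onI) (auto simp: q_def assms(2) split: if_splits; presburger)
    show "q i \<in> I" if "i \<in> I" for i
      using that assms(1) by (auto simp: q_def assms(2) split: if_splits; presburger)
  qed (simp add: assms(2))
  moreover have "bij_betw k I I"
  proof (rule bij_betw_endo)
    show "inj_on k I" by (rule inj_onI) (auto simp: k_def assms(2) split: if_splits; presburger)
    show "k i \<in> I" if "i \<in> I" for i
      using that assms(1) by (auto simp: k_def assms(2) split: if_splits; presburger)
  qed (simp add: assms(2))
  moreover have "\<forall>i\<in>I. 2 * (i div 2) + q i = k i + s - 1" unfolding q_def k_def by simp
  ultimately show ?thesis by blast
qed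

text \<open>The other rounding, which is \<open>0\<close> and \<open>2 * s\<close> at the two ends and pairs up the entries between them.
  The position \<open>0\<close> now starts the sweep of the odd positions.\<close>
lemma index_merge_minus:
  fixes s :: int
  assumes "1 \<le> s" "I = {0..<2 * s}"
  shows "\<exists>q k. bij_betw q I I \<and> bij_betw k I I \<and>
           (\<forall>i\<in>I. 2 * ((i + 1) div 2) + q i = k i + s)"
proof -
  define q where "q i = (if i = 0 then s else if even i then 2 * s - i div 2
    else s - (i + 1) div 2)" for i :: int
  define k where "k i = (if i = 0 then 0 else if even i then s + i div 2
    else (i + 1) div 2)" for i :: int
  have "bij_betw q I I"
  proof (rule bij_betw_endo)
    show "inj_on q I" by (rule inj_onI) (auto simp: q_def assms(2) split: if_splits; presburger)
    show "q i \<in> I" if "i \<in> I" for i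
      using that assms(1) by (auto simp: q_def assms(2) split: if_splits; presburger)
  qed (simp add: assms(2))
  moreover have "bij_betw k I I"
  proof (rule bij_betw_endo)
    show "inj_on k I" by (rule inj_onI) (auto simp: k_def assms(2) split: if_splits; presburger)
    show "k i \<in> I" if "i \<in> I" for i
      using that assms(1) by (auto simp: k_def assms(2) split: if_splits; presburger)
  qed (simp add: assms(2))
  moreover have "\<forall>i\<in>I. 2 * ((i + 1) div 2) + q i = k i + s"
    by (auto simp: q_def k_def; presburger)
  ultimately show ?thesis by blast
qed

text \<open>Two exact progressions of even length have a rounded sum. It is obtained by rotating the second one
  by half its length, which makes each value of the sum occur twice.\<close>
lemma index_merge_zero:
  fixes s :: int
  assumes "1 \<le> s" "I = {0..<2 * s}"
  shows "\<exists>q k. bij_betw q I I \<and> bij_betw k I I \<and> (\<forall>i\<in>I. i + q i = 2 * (k i div 2) + s)"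
proof -
  define q where "q i = (if i < s then s + i else i - s)" for i :: int
  define k where "k i = (if i < s then 2 * i + 1 else 2 * (i - s))" for i :: int
  have "bij_betw q I I"
  proof (rule bij_betw_endo)
    show "inj_on q I" by (rule inj_onI) (auto simp: q_def assms(2) split: if_splits; presburger)
    show "q i \<in> I" if "i \<in> I" for i
      using that assms(1) by (auto simp: q_def assms(2) split: if_splits; presburger)
  qed (simp add: assms(2))
  moreover have "bij_betw k I I"
  proof (rule bij_betw_endo)
    show "inj_on k I" by (rule inj_onI) (auto simp: k_def assms(2) split: if_splits; presburger)
    show "k i \<in> I" if "i \<in> I" for i
      using that assms(1) by (auto simp: k_def assms(2) split: if_splits; presburger)
  qed (simp add: assms(2))
  moreover have "\<forall>i\<in>I. i + q i = 2 * (k i div 2) + s" unfolding q_def k_def by auto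
  ultimately show ?thesis by blast
qed

text \<open>A rounded progression can be added to a progression of any kind: the amount \<open>2 * i + wave d i\<close> is
  \<open>4 * t + 1\<close> or \<open>4 * t - 1\<close>, so the rounding of the sum is that of the second summand, up to a shift.\<close>
lemma wave_index_merge_nonzero:
  fixes s d d' :: int
  assumes "1 \<le> s" "I = {0..<2 * s}" "d \<in> {-1, 1}" "d' \<in> {-1, 0, 1}"
  shows "\<exists>q k. \<exists>c \<in> {-1, 0, 1}. bij_betw q I I \<and> bij_betw k I I \<and>
           (\<forall>i\<in>I. (2 * i + wave d i) + (2 * q i + wave d' (q i)) = 2 * k i + (2 * s - 1) + wave c (k i))"
proof (cases "d = 1")
  case True
  obtain q k where b: "bij_betw q I I" "bij_betw k I I"
    and e: "\<forall>i\<in>I. 2 * (i div 2) + q i = k i + s - 1"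
    using index_merge_plus[OF assms(1,2)] by blast
  have "(2 * i + wave d i) + (2 * q i + wave d' (q i)) = 2 * k i + (2 * s - 1) + wave (wave d' (s - 1)) (k i)"
    if "i \<in> I" for i
  proof -
    have q: "q i = k i + s - 1 - 2 * (i div 2)" using e that by fastforce
    have "2 * i + wave d i = 4 * (i div 2) + 1" unfolding wave_def True by (simp, presburger)
    moreover have "wave d' (q i) = wave (wave d' (s - 1)) (k i)" unfolding wave_def q by auto
    ultimately show ?thesis using q by simp
  qed
  moreover have "wave d' (s - 1) \<in> {-1, 0, 1}" using assms(4) by (auto simp: wave_def)
  ultimately show ?thesis using b by blast
next
  case False
  then have d: "d = -1" using assms(3) by auto
  obtain q k where b: "bij_betw q I I" "bij_betw k I I"
    and e: "\<forall>i\<in>I. 2 * ((i + 1) div 2) + q i = k i + s"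
    using index_merge_minus[OF assms(1,2)] by blast
  have "(2 * i + wave d i) + (2 * q i + wave d' (q i)) = 2 * k i + (2 * s - 1) + wave (wave d' s) (k i)"
    if "i \<in> I" for i
  proof -
    have q: "q i = k i + s - 2 * ((i + 1) div 2)" using e that by fastforce
    have "2 * i + wave d i = 4 * ((i + 1) div 2) - 1" unfolding wave_def d by (simp, presburger)
    moreover have "wave d' (q i) = wave (wave d' s) (k i)" unfolding wave_def q by auto
    ultimately show ?thesis using q by simp
  qed
  moreover have "wave d' s \<in> {-1, 0, 1}" using assms(4) by (auto simp: wave_def)
  ultimately show ?thesis using b by blast
qed

lemma wave_index_merge:
  fixes r d d' :: int
  assumes "1 \<le> r" "I = {0..<r}" "d \<in> {-1, 0, 1}" "d' \<in> {-1, 0, 1}"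
    and odd: "odd r \<Longrightarrow> d = 0 \<and> d' = 0"
  shows "\<exists>q k. \<exists>c \<in> {-1, 0, 1}. bij_betw q I I \<and> bij_betw k I I \<and>
           (\<forall>i\<in>I. (2 * i + wave d i) + (2 * q i + wave d' (q i)) = 2 * k i + (r - 1) + wave c (k i))"
proof (cases "even r")
  case False
  then obtain s where s: "r = 2 * s + 1" by (rule oddE)
  obtain q k where "bij_betw q I I" "bij_betw k I I" and e: "\<forall>i\<in>I. i + q i = k i + s"
    using index_merge_odd[of s I] assms(1,2) s by auto
  moreover have "\<forall>i\<in>I. (2 * i + wave d i) + (2 * q i + wave d' (q i)) = 2 * k i + (r - 1) + wave 0 (k i)"
    using e odd False s by (auto simp: wave_def)
  ultimately show ?thesis by blast
next
  case True
  then obtain s where s: "r = 2 * s" by (rule evenE)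
  have s1: "1 \<le> s" and I: "I = {0..<2 * s}" using assms(1,2) s by auto
  consider "d \<noteq> 0" | "d' \<noteq> 0" | "d = 0" "d' = 0" by blast
  then show ?thesis
  proof cases
    case 1
    with wave_index_merge_nonzero[OF s1 I, of d d'] assms(3,4) s show ?thesis by auto
  next
    case 2
    \<comment> \<open>The rounded progression is the second one: exchange the roles and reindex by the inverse of \<open>q\<close>.\<close>
    then obtain q k c where b: "bij_betw q I I" "bij_betw k I I" and c: "c \<in> {-1, 0, 1}"
      and e: "\<forall>i\<in>I. (2 * i + wave d' i) + (2 * q i + wave d (q i)) = 2 * k i + (2 * s - 1) + wave c (k i)"
      using wave_index_merge_nonzero[OF s1 I, of d' d] assms(3,4) by auto
    define p where "p = inv_into I q"
    have p: "bij_betw p I I" using b(1) unfolding p_def by (rule bij_betw_inv_into)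
    have "(2 * i + wave d i) + (2 * p i + wave d' (p i)) = 2 * (k \<circ> p) i + (r - 1) + wave c ((k \<circ> p) i)"
      if "i \<in> I" for i
    proof -
      have "p i \<in> I" using p that by (rule bij_betwE[rule_format])
      moreover have "q (p i) = i" unfolding p_def using b(1) that by (metis bij_betw_inv_into_right)
      ultimately show ?thesis using e s by fastforce
    qed
    moreover have "bij_betw (k \<circ> p) I I" using p b(2) by (rule bij_betw_trans)
    ultimately show ?thesis using p c by blast
  next
    case 3
    obtain q k where b: "bij_betw q I I" "bij_betw k I I" and e: "\<forall>i\<in>I. i + q i = 2 * (k i div 2) + s"
      using index_merge_zero[OF s1 I] by blast
    have "(2 * i + wave d i) + (2 * q i + wave d' (q i)) = 2 * k i + (r - 1) + wave 1 (k i)"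
      if "i \<in> I" for i
    proof -
      have "2 * k i + wave 1 (k i) = 4 * (k i div 2) + 1" unfolding wave_def by (simp, presburger)
      moreover have "wave d i = 0" "wave d' (q i) = 0" using 3 by (simp_all add: wave_def)
      ultimately show ?thesis using e[rule_format, OF that] s by linarith
    qed
    then show ?thesis using b by blast
  qed
qed

section \<open>Surplus profiles\<close>

text \<open>
  The arithmetic progression with difference \<open>1\<close> whose entries at \<open>0, \<dots>, r - 1\<close> have mean
  \<open>m * (r - 1) / 2\<close>, rounded to integers. By parity \<open>d = 0\<close> exactly if \<open>(m - 1) * (r - 1)\<close> is even, and
  then nothing is rounded. It is a function on all integers so that shifting needs no case distinction.
\<close>
definition profile :: "nat \<Rightarrow> nat \<Rightarrow> (int \<Rightarrow> int) \<Rightarrow> bool" where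
  "profile r m \<psi> \<longleftrightarrow>
     (\<exists>d \<in> {-1, 0, 1}. \<forall>x. 2 * \<psi> x = 2 * x + (int m - 1) * (int r - 1) + wave d x)"

lemma profileI:
  assumes "d \<in> {-1, 0, 1}" "even ((int m - 1) * (int r - 1) + d)"
  shows "profile r m (\<lambda>x. x + ((int m - 1) * (int r - 1) + wave d x) div 2)"
  unfolding profile_def
proof (rule bexI[OF _ assms(1)], rule allI)
  fix x
  have "even ((int m - 1) * (int r - 1) + wave d x)" using assms(2) by (auto simp: wave_def)
  then show "2 * (x + ((int m - 1) * (int r - 1) + wave d x) div 2)
      = 2 * x + (int m - 1) * (int r - 1) + wave d x" by auto
qed

text \<open>The profile of a path: cyclic colouring leaves the surpluses \<open>0, \<dots>, r - 1\<close> in some order.\<close>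
lemma profile_identity: "profile r 1 (\<lambda>x. x)"
  unfolding profile_def by (auto simp: wave_def)

lemma profile_odd:
  assumes "odd (int r)" "d \<in> {-1, 0, 1}"
    "\<forall>x. 2 * \<psi> x = 2 * x + (int m - 1) * (int r - 1) + wave d x"
  shows "d = 0"
proof -
  have "2 * \<psi> 0 = (int m - 1) * (int r - 1) + d" using assms(3)[rule_format, of 0] by (simp add: wave_def)
  moreover have "even ((int m - 1) * (int r - 1))" using assms(1) by simp
  ultimately have "even d" by (metis dvd_add_right_iff dvd_triv_left)
  then show ?thesis using assms(2) by auto
qed

lemma profile_merge:
  assumes "1 \<le> r" "profile r m \<psi>" "profile r m' \<psi>'" and I: "I = {0..<int r}"
  shows "\<exists>\<phi> q k. profile r (m + m') \<phi> \<and> bij_betw q I I \<and> bij_betw k I I \<and>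
           (\<forall>i\<in>I. \<psi> i + \<psi>' (q i) = \<phi> (k i))"
proof -
  obtain d d' where d: "d \<in> {-1, 0, 1}" "d' \<in> {-1, 0, 1}"
    and \<psi>: "\<forall>x. 2 * \<psi> x = 2 * x + (int m - 1) * (int r - 1) + wave d x"
    and \<psi>': "\<forall>x. 2 * \<psi>' x = 2 * x + (int m' - 1) * (int r - 1) + wave d' x"
    using assms(2,3) unfolding profile_def by blast
  have "d = 0 \<and> d' = 0" if "odd (int r)"
    using profile_odd[OF that d(1) \<psi>] profile_odd[OF that d(2) \<psi>'] by simp
  then obtain q k c where c: "c \<in> {-1, 0, 1}" and b: "bij_betw q I I" "bij_betw k I I"
    and e: "\<forall>i\<in>I. (2 * i + wave d i) + (2 * q i + wave d' (q i)) = 2 * k i + (int r - 1) + wave c (k i)"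
    using wave_index_merge[of "int r" I d d'] assms(1) I d by auto
  have sum: "2 * (\<psi> i + \<psi>' (q i)) = 2 * k i + (int (m + m') - 1) * (int r - 1) + wave c (k i)"
    if "i \<in> I" for i
    using e[rule_format, OF that] \<psi>[rule_format, of i] \<psi>'[rule_format, of "q i"]
    by (simp add: algebra_simps)
  have "0 \<in> I" using assms(1) I by simp
  have "even ((int (m + m') - 1) * (int r - 1) + wave c (k 0))"
    using sum[OF \<open>0 \<in> I\<close>] by (metis (no_types, opaque_lifting) add.assoc dvd_add_right_iff dvd_triv_left)
  then have ev: "even ((int (m + m') - 1) * (int r - 1) + c)"
    by (auto simp: wave_def split: if_splits)
  let ?\<phi> = "\<lambda>x. x + ((int (m + m') - 1) * (int r - 1) + wave c x) div 2"
  have "\<psi> i + \<psi>' (q i) = ?\<phi> (k i)" if "i \<in> I" for i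
    using sum[OF that] by presburger
  then show ?thesis using profileI[OF c ev] b by blast
qed

text \<open>
  Together with \<open>profile_period\<close> this describes a new root edge: each colour moves down one position
  and loses \<open>1\<close>, while the colour at position \<open>0\<close> moves to position \<open>r - 1\<close> and gains \<open>r - 1\<close>.
\<close>
lemma profile_shift:
  assumes "profile r m \<psi>"
  shows "profile r m (\<lambda>x. \<psi> (x + 1) - 1)"
proof -
  obtain d where d: "d \<in> {-1, 0, 1}" "\<forall>x. 2 * \<psi> x = 2 * x + (int m - 1) * (int r - 1) + wave d x"
    using assms unfolding profile_def by blast
  have "- d \<in> {-1, 0, 1}" using d(1) by auto
  moreover have "\<forall>x. 2 * (\<psi> (x + 1) - 1) = 2 * x + (int m - 1) * (int r - 1) + wave (- d) x"
  proof
    fix x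
    show "2 * (\<psi> (x + 1) - 1) = 2 * x + (int m - 1) * (int r - 1) + wave (- d) x"
      using d(2)[rule_format, of "x + 1"] by (auto simp: wave_def)
  qed
  ultimately show ?thesis unfolding profile_def by blast
qed

lemma profile_period:
  assumes "profile r m \<psi>"
  shows "\<psi> (x + int r) = \<psi> x + int r"
proof -
  obtain d where d: "d \<in> {-1, 0, 1}" "\<forall>x. 2 * \<psi> x = 2 * x + (int m - 1) * (int r - 1) + wave d x"
    using assms unfolding profile_def by blast
  have "wave d (x + int r) = wave d x"
    using profile_odd[OF _ d] by (cases "even (int r)") (auto simp: wave_def)
  then show ?thesis using d(2)[rule_format, of x] d(2)[rule_format, of "x + int r"] by simp
qed

lemma profile_nonneg:
  assumes "profile r m \<psi>" "1 \<le> m" "2 \<le> r" "0 \<le> x"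
  shows "0 \<le> \<psi> x"
proof -
  obtain d where d: "d \<in> {-1, 0, 1}" "2 * \<psi> x = 2 * x + (int m - 1) * (int r - 1) + wave d x"
    using assms(1) unfolding profile_def by blast
  have "0 \<le> (int m - 1) * (int r - 1)" using assms by simp
  moreover have "-1 \<le> wave d x" using d(1) by (auto simp: wave_def)
  ultimately show ?thesis using d(2) assms(4) by linarith
qed

text \<open>The intended upper bound for a tree with \<open>m\<close> leaves and one further leaf as its root.\<close>
definition bound :: "nat \<Rightarrow> nat \<Rightarrow> int" where
  "bound r m = \<lceil>(real r - 1) * (real (m + 1) / 2)\<rceil>"

lemma bound_mono: "1 \<le> r \<Longrightarrow> m \<le> m' \<Longrightarrow> bound r m \<le> bound r m'"
  unfolding bound_def by (intro ceiling_mono mult_left_mono) auto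

lemma profile_le_bound:
  assumes "profile r m \<psi>" "x < int r"
  shows "\<psi> x \<le> bound r m"
proof -
  obtain d where d: "d \<in> {-1, 0, 1}" "2 * \<psi> x = 2 * x + (int m - 1) * (int r - 1) + wave d x"
    using assms(1) unfolding profile_def by blast
  have "wave d x \<le> 1" using d(1) by (auto simp: wave_def)
  then have "2 * \<psi> x \<le> 2 * (int r - 1) + (int m - 1) * (int r - 1) + 1" using d(2) assms(2) by (smt (verit))
  also have "\<dots> = (int r - 1) * (int m + 1) + 1" by (simp add: algebra_simps)
  finally have "real_of_int (2 * \<psi> x) \<le> real_of_int ((int r - 1) * (int m + 1) + 1)" by linarith
  then have "2 * real_of_int (\<psi> x) \<le> (real r - 1) * (real m + 1) + 1" by simp
  moreover have "(real r - 1) * (real (m + 1) / 2) = (real r - 1) * (real m + 1) / 2" by simp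
  ultimately have "real_of_int (\<psi> x) - 1 < (real r - 1) * (real (m + 1) / 2)" by linarith
  then show ?thesis unfolding bound_def by linarith
qed


section \<open>Rooted trees\<close>

text \<open>Subtrees enter the surplus only through their edges, so connectivity is phrased for edge sets; the
  graph consisting of one vertex becomes the empty set.\<close>

definition adj :: "'a set set \<Rightarrow> 'a rel" where
  "adj X = {(x, y). {x, y} \<in> X}"

definition linked :: "'a set set \<Rightarrow> 'a \<Rightarrow> bool" where
  "linked X v \<longleftrightarrow> (\<forall>x \<in> \<Union>X. (x, v) \<in> (adj X)\<^sup>*)"

definition connected_edges :: "'a set set \<Rightarrow> bool" where
  "connected_edges X \<longleftrightarrow> (\<forall>v \<in> \<Union>X. linked X v)"

lemma adj_mono: "X \<subseteq> Y \<Longrightarrow> (adj X)\<^sup>* \<subseteq> (adj Y)\<^sup>*"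
  by (rule rtrancl_mono) (auto simp: adj_def)

lemma adj_rtrancl_sym: "(x, y) \<in> (adj X)\<^sup>* \<Longrightarrow> (y, x) \<in> (adj X)\<^sup>*"
  by (rule symD[OF sym_rtrancl]) (auto simp: sym_def adj_def insert_commute)

lemma adj_invariant:
  assumes "(a, b) \<in> (adj X)\<^sup>*" "P a"
    and "\<And>y z. {y, z} \<in> X \<Longrightarrow> P y \<Longrightarrow> P z"
  shows "P b"
  using assms(1,2) by (induction rule: rtrancl_induct) (use assms(3) in \<open>auto simp: adj_def\<close>)

text \<open>
  The construction steps that match the colouring: lengthen the tree at the root, or glue two
  nontrivial trees at their common root. The last argument counts the leaves apart from the root; a
  single vertex counts as \<open>1\<close>, because it becomes such a leaf as soon as an edge is added.
\<close>
inductive rooted_tree :: "'a set set \<Rightarrow> 'a \<Rightarrow> nat \<Rightarrow> bool" where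
  single: "rooted_tree {} v 1"
| extend: "rooted_tree E v m \<Longrightarrow> u \<notin> insert v (\<Union>E) \<Longrightarrow> rooted_tree (insert {u, v} E) u m"
| merge: "rooted_tree E v m \<Longrightarrow> rooted_tree E' v m' \<Longrightarrow> E \<noteq> {} \<Longrightarrow> E' \<noteq> {} \<Longrightarrow>
    E \<inter> E' = {} \<Longrightarrow> \<Union>E \<inter> \<Union>E' \<subseteq> {v} \<Longrightarrow> rooted_tree (E \<union> E') v (m + m')"

lemma rooted_tree_finite: "rooted_tree E v m \<Longrightarrow> finite E"
  by (induction rule: rooted_tree.induct) auto

lemma rooted_tree_root: "rooted_tree E v m \<Longrightarrow> E \<noteq> {} \<Longrightarrow> v \<in> \<Union>E"
  by (induction rule: rooted_tree.induct) auto

lemma rooted_tree_linked: "rooted_tree E v m \<Longrightarrow> linked E v"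
proof (induction rule: rooted_tree.induct)
  case (single v)
  show ?case by (simp add: linked_def)
next
  case (extend E v m u)
  let ?E = "insert {u, v} E"
  have vu: "(v, u) \<in> (adj ?E)\<^sup>*" by (auto simp: adj_def insert_commute)
  have "(x, u) \<in> (adj ?E)\<^sup>*" if "x \<in> \<Union>?E" for x
  proof -
    from that consider "x = u" | "x = v" | "x \<in> \<Union>E" by auto
    then show ?thesis
    proof cases
      case 3
      then have "(x, v) \<in> (adj ?E)\<^sup>*"
        using extend.IH adj_mono[of E ?E] by (auto simp: linked_def)
      then show ?thesis using vu by (rule rtrancl_trans)
    qed (use vu in auto)
  qed
  then show ?case by (simp add: linked_def)
next
  case (merge E v m E' m')
  have "(x, v) \<in> (adj (E \<union> E'))\<^sup>*" if "x \<in> \<Union>(E \<union> E')" for x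
  proof -
    from that consider "x \<in> \<Union>E" | "x \<in> \<Union>E'" by blast
    then have "(x, v) \<in> (adj E)\<^sup>* \<or> (x, v) \<in> (adj E')\<^sup>*"
      by cases (use merge.IH in \<open>auto simp only: linked_def\<close>)
    then show ?thesis using adj_mono[OF Un_upper1, of E E'] adj_mono[OF Un_upper2, of E' E] by blast
  qed
  then show ?case by (simp add: linked_def)
qed

text \<open>The leaves apart from the root \<open>v\<close>, read off the edge set so that the recursion need not carry a
  vertex set.\<close>
definition tips :: "'a set set \<Rightarrow> 'a \<Rightarrow> 'a set" where
  "tips E v = {x \<in> \<Union>E - {v}. card {e \<in> E. x \<in> e} = 1}"

lemma rooted_tree_tips:
  "rooted_tree E v m \<Longrightarrow> 1 \<le> m \<and> (if E = {} then m = 1 else finite (tips E v) \<and> m = card (tips E v))"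
proof (induction rule: rooted_tree.induct)
  case (single v)
  show ?case by simp
next
  case (extend E v m u)
  show ?case
  proof (cases "E = {}")
    case True
    have "tips {{u, v}} u = {v}" using extend.hyps(2) by (auto simp: tips_def card_1_singleton_iff)
    then show ?thesis using True extend.IH by simp
  next
    case False
    let ?E = "insert {u, v} E"
    have v: "v \<in> \<Union>E" using rooted_tree_root[OF extend.hyps(1) False] .
    have "card {e \<in> ?E. v \<in> e} \<noteq> 1"
    proof
      obtain e where e: "e \<in> E" "v \<in> e" using v by blast
      assume "card {e \<in> ?E. v \<in> e} = 1"
      then obtain e' where "{e \<in> ?E. v \<in> e} = {e'}" by (auto simp: card_1_singleton_iff)
      moreover have "e \<in> {e \<in> ?E. v \<in> e}" "{u, v} \<in> {e \<in> ?E. v \<in> e}" using e by simp_all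
      ultimately have "e = {u, v}" by simp
      then show False using e extend.hyps(2) by auto
    qed
    then have nt: "v \<notin> tips ?E u" unfolding tips_def by blast
    have "x \<in> tips ?E u \<longleftrightarrow> x \<in> tips E v" for x
    proof -
      consider "x = u" | "x = v" | "x \<noteq> u" "x \<noteq> v" by blast
      then show ?thesis
      proof cases
        case 1
        then show ?thesis using extend.hyps(2) by (simp add: tips_def)
      next
        case 2
        then show ?thesis using nt by (simp add: tips_def)
      next
        case 3
        then have "{e \<in> ?E. x \<in> e} = {e \<in> E. x \<in> e}" by auto
        then show ?thesis using 3 by (simp add: tips_def)
      qed
    qed
    then have "tips ?E u = tips E v" by blast
    then show ?thesis using False extend.IH by simp
  qed
next
  case (merge E v m E' m')
  have "x \<in> tips (E \<union> E') v \<longleftrightarrow> x \<in> tips E v \<or> x \<in> tips E' v" for x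
  proof -
    consider "x = v" | "x \<notin> \<Union>(E \<union> E')" | "x \<in> \<Union>E" "x \<notin> \<Union>E'" | "x \<in> \<Union>E'" "x \<notin> \<Union>E"
      using merge.hyps(6) by blast
    then show ?thesis
    proof cases
      case 3
      then have "{e \<in> E \<union> E'. x \<in> e} = {e \<in> E. x \<in> e}" by blast
      then show ?thesis using 3 by (simp add: tips_def)
    next
      case 4
      then have "{e \<in> E \<union> E'. x \<in> e} = {e \<in> E'. x \<in> e}" by blast
      then show ?thesis using 4 by (simp add: tips_def)
    qed (simp_all add: tips_def)
  qed
  then have "tips (E \<union> E') v = tips E v \<union> tips E' v" by blast
  moreover have "tips E v \<inter> tips E' v = {}" using merge.hyps(6) by (auto simp: tips_def)
  ultimately show ?case using merge.IH merge.hyps(3,4) by (simp add: card_Un_disjoint)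
qed

text \<open>
  A pendant edge may be attached anywhere, not only at the root. This makes a maximal rooted tree
  inside a connected graph spanning. At the root itself the new edge is glued on as a separate tree.
\<close>
lemma rooted_tree_add_edge:
  "rooted_tree E v m \<Longrightarrow> w \<in> insert v (\<Union>E) \<Longrightarrow> u \<notin> insert v (\<Union>E) \<Longrightarrow>
    \<exists>m'. rooted_tree (insert {w, u} E) v m'"
proof (induction rule: rooted_tree.induct)
  case (single v)
  then show ?case using rooted_tree.extend[OF rooted_tree.single, of v u] by auto
next
  case (extend E v m x)
  let ?E = "insert {x, v} E"
  show ?case
  proof (cases "w = x")
    case True
    have "rooted_tree {{x, u}} x 1"
      using rooted_tree.extend[OF rooted_tree.single, of x u] extend.prems by auto
    moreover have "rooted_tree ?E x m" using extend.hyps by (rule rooted_tree.extend)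
    ultimately have "rooted_tree ({{x, u}} \<union> ?E) x (1 + m)"
      using extend.prems by (intro rooted_tree.merge) auto
    then show ?thesis using True by (metis insert_is_Un)
  next
    case False
    then obtain m' where "rooted_tree (insert {w, u} E) v m'"
      using extend.IH extend.prems by auto
    then have "rooted_tree (insert {x, v} (insert {w, u} E)) x m'"
      using extend.hyps(2) extend.prems False by (intro rooted_tree.extend) auto
    then show ?thesis by (metis insert_commute)
  qed
next
  case (merge E v m E' m')
  show ?case
  proof (cases "w \<in> insert v (\<Union>E)")
    case True
    then obtain k where k: "rooted_tree (insert {w, u} E) v k" using merge.IH merge.prems by auto
    have "rooted_tree (insert {w, u} E \<union> E') v (k + m')"
      using merge.hyps merge.prems True by (intro rooted_tree.merge[OF k]) auto
    then show ?thesis by auto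
  next
    case False
    then obtain k where k: "rooted_tree (insert {w, u} E') v k" using merge.IH merge.prems by auto
    have "rooted_tree (E \<union> insert {w, u} E') v (m + k)"
      using merge.hyps merge.prems False by (intro rooted_tree.merge[OF _ k]) auto
    then show ?thesis by auto
  qed
qed

section \<open>Colouring a rooted tree\<close>

definition surplus :: "nat \<Rightarrow> ('a set \<Rightarrow> nat) \<Rightarrow> 'a set set \<Rightarrow> nat \<Rightarrow> int" where
  "surplus r f X j = (\<Sum>e\<in>X. if f e = j then int r - 1 else - 1)"

lemma surplus_eq:
  assumes "finite X"
  shows "surplus r f X j = int r * int (card {e \<in> X. f e = j}) - int (card X)"
proof -
  have "surplus r f X j = (\<Sum>e\<in>X. (if f e = j then int r else 0) - 1)"
    unfolding surplus_def by (rule sum.cong) auto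
  also have "\<dots> = int r * int (card {e \<in> X. f e = j}) - int (card X)"
    using assms by (simp add: sum_subtractf sum.If_cases Int_def mult.commute)
  finally show ?thesis .
qed

lemma surplus_cong: "(\<And>e. e \<in> X \<Longrightarrow> f e = g e) \<Longrightarrow> surplus r f X j = surplus r g X j"
  unfolding surplus_def by (rule sum.cong) auto

text \<open>Two parts of a tree glued at \<open>v\<close> are separated by \<open>v\<close>: a walk that avoids \<open>v\<close> stays in its part.\<close>
lemma connected_edges_split:
  assumes "connected_edges X" "X \<subseteq> E \<union> E'" "\<Union>E \<inter> \<Union>E' \<subseteq> {v}" "v \<notin> \<Union>X" "{} \<notin> X"
  shows "X \<subseteq> E \<or> X \<subseteq> E'"
proof (rule ccontr)
  assume "\<not> ?thesis"
  then obtain e e' where e: "e \<in> X" "e \<in> E" "e' \<in> X" "e' \<in> E'" "e' \<notin> E" using assms(2) by blast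
  obtain a b where ab: "a \<in> e" "b \<in> e'" using e assms(5) by (metis all_not_in_conv)
  have "(a, b) \<in> (adj X)\<^sup>*" using assms(1) e ab by (auto simp: connected_edges_def linked_def)
  moreover have "a \<in> \<Union>E - {v}" using e ab assms(4) by blast
  moreover have "z \<in> \<Union>E - {v}" if "{y, z} \<in> X" "y \<in> \<Union>E - {v}" for y z
  proof -
    have "z \<noteq> v" using that(1) assms(4) by blast
    moreover have "{y, z} \<in> E" using that assms(2,3) by blast
    ultimately show ?thesis by blast
  qed
  ultimately have "b \<in> \<Union>E - {v}" by (rule adj_invariant)
  then show False using e ab assms(3) by blast
qed

text \<open>A walk towards the pendant vertex \<open>u\<close> reaches \<open>v\<close> before it uses the edge to \<open>u\<close>.\<close>
lemma linked_remove_leaf: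
  assumes "linked X u" "u \<notin> insert v (\<Union>E)" "X \<subseteq> insert {u, v} E"
  shows "linked (X - {{u, v}}) v"
proof -
  let ?X = "X - {{u, v}}"
  have "(x, v) \<in> (adj ?X)\<^sup>*" if "(x, u) \<in> (adj X)\<^sup>*" "x \<noteq> u" for x
    using that
  proof (induction rule: converse_rtrancl_induct)
    case (step x y)
    have xy: "{x, y} \<in> X" using step.hyps(1) by (simp add: adj_def)
    show ?case
    proof (cases "{x, y} = {u, v}")
      case True
      then show ?thesis using step.prems by (auto simp: doubleton_eq_iff)
    next
      case False
      then have "y \<noteq> u" using xy assms(2,3) by blast
      moreover have "(x, y) \<in> adj ?X" using xy False by (simp add: adj_def)
      ultimately show ?thesis using step.IH by (meson converse_rtrancl_into_rtrancl)
    qed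
  qed simp
  moreover have "x \<noteq> u" "(x, u) \<in> (adj X)\<^sup>*" if "x \<in> \<Union>?X" for x
    using that assms by (auto simp: linked_def)
  ultimately show ?thesis by (auto simp: linked_def)
qed

text \<open>A walk towards the cut vertex \<open>v\<close> stays in the part where it starts until it reaches \<open>v\<close>.\<close>
lemma linked_restrict:
  assumes "linked X v" "X \<subseteq> E \<union> E'" "\<Union>E \<inter> \<Union>E' \<subseteq> {v}"
  shows "linked (X \<inter> E) v"
proof -
  have "(x, v) \<in> (adj (X \<inter> E))\<^sup>*" if "(x, v) \<in> (adj X)\<^sup>*" "x \<in> insert v (\<Union>E)" for x
    using that
  proof (induction rule: converse_rtrancl_induct)
    case (step x y)
    have xy: "{x, y} \<in> X" using step.hyps(1) by (simp add: adj_def)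
    show ?case
    proof (cases "x = v")
      case False
      then have "{x, y} \<in> E" using xy step.prems assms(2,3) by blast
      then have "(x, y) \<in> adj (X \<inter> E)" "y \<in> insert v (\<Union>E)" using xy by (auto simp: adj_def)
      then show ?thesis using step.IH by (meson converse_rtrancl_into_rtrancl)
    qed simp
  qed simp
  then show ?thesis using assms(1) by (auto simp: linked_def)
qed

lemma rooted_tree_no_empty: "rooted_tree E v m \<Longrightarrow> {} \<notin> E"
  by (induction rule: rooted_tree.induct) auto

text \<open>
  The order \<open>\<sigma>\<close> in which the entries of the profile are assigned to the colours can be prescribed. This
  is what allows the two parts at a branching vertex to be matched, and it holds as renaming the
  colours changes nothing. Subtrees that miss the root are bounded by the induction hypothesis, because
  \<open>bound\<close> grows with the number of leaves.
\<close>
lemma rooted_tree_coloring: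
  assumes "2 \<le> r" "rooted_tree E v m"
  shows "\<exists>\<psi>. profile r m \<psi> \<and> (\<forall>\<sigma>. bij_betw \<sigma> {1..r} {0..<int r} \<longrightarrow>
    (\<exists>f. f ` E \<subseteq> {1..r} \<and>
       (\<forall>X j. X \<subseteq> E \<longrightarrow> linked X v \<longrightarrow> j \<in> {1..r} \<longrightarrow> surplus r f X j \<le> \<psi> (\<sigma> j)) \<and>
       (\<forall>X j. X \<subseteq> E \<longrightarrow> connected_edges X \<longrightarrow> j \<in> {1..r} \<longrightarrow> surplus r f X j \<le> bound r m)))"
  using assms(2)
proof (induction rule: rooted_tree.induct)
  case (single v)
  have nonneg: "0 \<le> \<sigma> j" if "bij_betw \<sigma> {1..r} {0..<int r}" "j \<in> {1..r}" for \<sigma> j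
    using bij_betwE[OF that(1)] that(2) by auto
  have "0 \<le> bound r 1"
    using profile_le_bound[OF profile_identity, of 0 r] assms(1) by simp
  then show ?case
    by (intro exI[of _ "\<lambda>x. x"]) (auto simp: profile_identity[simplified] surplus_def nonneg)
next
  case (extend E v m u)
  obtain \<psi> where \<psi>: "profile r m \<psi>"
    and col: "\<And>\<sigma>. bij_betw \<sigma> {1..r} {0..<int r} \<Longrightarrow> \<exists>f. f ` E \<subseteq> {1..r} \<and>
       (\<forall>X j. X \<subseteq> E \<longrightarrow> linked X v \<longrightarrow> j \<in> {1..r} \<longrightarrow> surplus r f X j \<le> \<psi> (\<sigma> j)) \<and>
       (\<forall>X j. X \<subseteq> E \<longrightarrow> connected_edges X \<longrightarrow> j \<in> {1..r} \<longrightarrow> surplus r f X j \<le> bound r m)"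
    using extend.IH by blast
  let ?\<phi> = "\<lambda>x. \<psi> (x + 1) - 1"
  let ?E = "insert {u, v} E"
  have \<phi>: "profile r m ?\<phi>" using \<psi> by (rule profile_shift)
  have m: "1 \<le> m" using rooted_tree_tips[OF extend.hyps(1)] by simp
  have "\<exists>f. f ` ?E \<subseteq> {1..r} \<and>
       (\<forall>X j. X \<subseteq> ?E \<longrightarrow> linked X u \<longrightarrow> j \<in> {1..r} \<longrightarrow> surplus r f X j \<le> ?\<phi> (\<tau> j)) \<and>
       (\<forall>X j. X \<subseteq> ?E \<longrightarrow> connected_edges X \<longrightarrow> j \<in> {1..r} \<longrightarrow> surplus r f X j \<le> bound r m)"
    if \<tau>: "bij_betw \<tau> {1..r} {0..<int r}" for \<tau>
  proof -
    \<comment> \<open>The positions before the new edge is added; the colour that is lowest there has to end up highest.\<close>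
    define \<rho> where "\<rho> x = (if x = int r - 1 then 0 else x + 1)" for x :: int
    have \<rho>: "bij_betw \<rho> {0..<int r} {0..<int r}"
      by (rule bij_betw_endo) (use assms(1) in \<open>auto simp: \<rho>_def inj_on_def\<close>)
    have \<sigma>: "bij_betw (\<rho> \<circ> \<tau>) {1..r} {0..<int r}" using \<tau> \<rho> by (rule bij_betw_trans)
    obtain f where f: "f ` E \<subseteq> {1..r}"
      and root: "\<And>X j. X \<subseteq> E \<Longrightarrow> linked X v \<Longrightarrow> j \<in> {1..r} \<Longrightarrow> surplus r f X j \<le> \<psi> (\<rho> (\<tau> j))"
      and all: "\<And>X j. X \<subseteq> E \<Longrightarrow> connected_edges X \<Longrightarrow> j \<in> {1..r} \<Longrightarrow> surplus r f X j \<le> bound r m"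
      using col[OF \<sigma>] by auto
    have "int r - 1 \<in> \<tau> ` {1..r}" using \<tau> assms(1) by (auto simp: bij_betw_def)
    then obtain c where c: "c \<in> {1..r}" "\<tau> c = int r - 1" by (metis imageE)
    define g where "g = f({u, v} := c)"
    have new: "{u, v} \<notin> E" using extend.hyps(2) by auto
    have same: "surplus r g X j = surplus r f X j" if "X \<subseteq> E" for X j
      using that new by (intro surplus_cong) (auto simp: g_def)
    have root': "surplus r g X j \<le> ?\<phi> (\<tau> j)" if X: "X \<subseteq> ?E" "linked X u" and j: "j \<in> {1..r}" for X j
    proof -
      have \<tau>j: "0 \<le> \<tau> j" "\<tau> j < int r" using bij_betwE[OF \<tau>] j by auto
      show ?thesis
      proof (cases "{u, v} \<in> X")
        case True
        let ?X = "X - {{u, v}}"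
        have fin: "finite X" using X(1) rooted_tree_finite[OF extend.hyps(1)] by (simp add: finite_subset)
        have sub: "?X \<subseteq> E" using X(1) by blast
        have "surplus r g X j = (if c = j then int r - 1 else - 1) + surplus r g ?X j"
          unfolding surplus_def using fin True by (subst sum.remove[of _ "{u, v}"]) (auto simp: g_def)
        also have "surplus r g ?X j = surplus r f ?X j" using sub by (rule same)
        also have "surplus r f ?X j \<le> \<psi> (\<rho> (\<tau> j))"
          using root[OF sub linked_remove_leaf[OF X(2) extend.hyps(2) X(1)] j] .
        finally have le: "surplus r g X j \<le> (if c = j then int r - 1 else - 1) + \<psi> (\<rho> (\<tau> j))" by simp
        show ?thesis
        proof (cases "c = j")
          case True
          then have "\<psi> (\<tau> j + 1) = \<psi> (\<rho> (\<tau> j)) + int r"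
            using c profile_period[OF \<psi>, of 0] by (simp add: \<rho>_def)
          then show ?thesis using le True by simp
        next
          case False
          then have "\<tau> j \<noteq> int r - 1"
            using c j \<tau> by (metis bij_betw_imp_inj_on inj_on_def)
          then show ?thesis using le False by (simp add: \<rho>_def)
        qed
      next
        case False
        then have "X \<subseteq> E" using X(1) by blast
        have "X = {}"
        proof (rule ccontr)
          assume "X \<noteq> {}"
          then obtain e x where "e \<in> X" "x \<in> e"
            using \<open>X \<subseteq> E\<close> rooted_tree_no_empty[OF extend.hyps(1)] by (metis all_not_in_conv subsetD)
          then have xu: "(x, u) \<in> (adj X)\<^sup>*" "x \<in> \<Union>E" using X(2) \<open>X \<subseteq> E\<close> by (auto simp: linked_def)
          have "u \<in> \<Union>E" using xu by (rule adj_invariant) (use \<open>X \<subseteq> E\<close> in auto)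
          then show False using extend.hyps(2) by simp
        qed
        then show ?thesis using profile_nonneg[OF \<phi> m assms(1) \<tau>j(1)] by (simp add: surplus_def)
      qed
    qed
    have all': "surplus r g X j \<le> bound r m" if X: "X \<subseteq> ?E" "connected_edges X" and j: "j \<in> {1..r}" for X j
    proof (cases "{u, v} \<in> X")
      case True
      then have "linked X u" using X(2) by (auto simp: connected_edges_def)
      then have "surplus r g X j \<le> ?\<phi> (\<tau> j)" using root' X(1) j by blast
      also have "\<dots> \<le> bound r m" using profile_le_bound[OF \<phi>] bij_betwE[OF \<tau>] j by auto
      finally show ?thesis .
    next
      case False
      then have "X \<subseteq> E" using X(1) by blast
      then show ?thesis using all X(2) j same by metis
    qed
    have "g ` ?E \<subseteq> {1..r}" using f c(1) by (auto simp: g_def)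
    then show ?thesis using root' all' by blast
  qed
  then show ?case using \<phi> by blast
next
  case (merge E v m E' m')
  obtain \<psi> where \<psi>: "profile r m \<psi>"
    and col: "\<And>\<sigma>. bij_betw \<sigma> {1..r} {0..<int r} \<Longrightarrow> \<exists>f. f ` E \<subseteq> {1..r} \<and>
       (\<forall>X j. X \<subseteq> E \<longrightarrow> linked X v \<longrightarrow> j \<in> {1..r} \<longrightarrow> surplus r f X j \<le> \<psi> (\<sigma> j)) \<and>
       (\<forall>X j. X \<subseteq> E \<longrightarrow> connected_edges X \<longrightarrow> j \<in> {1..r} \<longrightarrow> surplus r f X j \<le> bound r m)"
    using merge.IH(1) by blast
  obtain \<psi>' where \<psi>': "profile r m' \<psi>'"
    and col': "\<And>\<sigma>. bij_betw \<sigma> {1..r} {0..<int r} \<Longrightarrow> \<exists>f. f ` E' \<subseteq> {1..r} \<and>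
       (\<forall>X j. X \<subseteq> E' \<longrightarrow> linked X v \<longrightarrow> j \<in> {1..r} \<longrightarrow> surplus r f X j \<le> \<psi>' (\<sigma> j)) \<and>
       (\<forall>X j. X \<subseteq> E' \<longrightarrow> connected_edges X \<longrightarrow> j \<in> {1..r} \<longrightarrow> surplus r f X j \<le> bound r m')"
    using merge.IH(2) by blast
  define I where "I = {0..<int r}"
  obtain \<phi> q k where \<phi>: "profile r (m + m') \<phi>" and q: "bij_betw q I I" and k: "bij_betw k I I"
    and qk: "\<forall>i\<in>I. \<psi> i + \<psi>' (q i) = \<phi> (k i)"
    using profile_merge[OF _ \<psi> \<psi>' I_def] assms(1) by auto
  have "\<exists>f. f ` (E \<union> E') \<subseteq> {1..r} \<and>
       (\<forall>X j. X \<subseteq> E \<union> E' \<longrightarrow> linked X v \<longrightarrow> j \<in> {1..r} \<longrightarrow> surplus r f X j \<le> \<phi> (\<tau> j)) \<and>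
       (\<forall>X j. X \<subseteq> E \<union> E' \<longrightarrow> connected_edges X \<longrightarrow> j \<in> {1..r} \<longrightarrow> surplus r f X j \<le> bound r (m + m'))"
    if \<tau>': "bij_betw \<tau> {1..r} {0..<int r}" for \<tau>
  proof -
    have \<tau>: "bij_betw \<tau> {1..r} I" using \<tau>' by (simp add: I_def)
    \<comment> \<open>Prescribe \<open>\<sigma>\<close> and \<open>q \<circ> \<sigma>\<close> in the two parts, so that the sum has the prescribed order \<open>k \<circ> \<sigma> = \<tau>\<close>.\<close>
    define \<sigma> where "\<sigma> = inv_into I k \<circ> \<tau>"
    have \<sigma>: "bij_betw \<sigma> {1..r} I"
      unfolding \<sigma>_def using \<tau> bij_betw_inv_into[OF k] by (rule bij_betw_trans)
    have \<sigma>': "bij_betw (q \<circ> \<sigma>) {1..r} I" using \<sigma> q by (rule bij_betw_trans)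
    have sum: "\<psi> (\<sigma> j) + \<psi>' (q (\<sigma> j)) = \<phi> (\<tau> j)" if "j \<in> {1..r}" for j
    proof -
      have "\<sigma> j \<in> I" "\<tau> j \<in> I" using \<sigma> \<tau> that by (auto dest: bij_betwE)
      moreover have "k (\<sigma> j) = \<tau> j"
        unfolding \<sigma>_def using bij_betw_inv_into_right[OF k \<open>\<tau> j \<in> I\<close>] by simp
      ultimately show ?thesis using qk by metis
    qed
    obtain f where f: "f ` E \<subseteq> {1..r}"
      and root: "\<And>X j. X \<subseteq> E \<Longrightarrow> linked X v \<Longrightarrow> j \<in> {1..r} \<Longrightarrow> surplus r f X j \<le> \<psi> (\<sigma> j)"
      and all: "\<And>X j. X \<subseteq> E \<Longrightarrow> connected_edges X \<Longrightarrow> j \<in> {1..r} \<Longrightarrow> surplus r f X j \<le> bound r m"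
      using col[OF \<sigma>[unfolded I_def]] by auto
    obtain f' where f': "f' ` E' \<subseteq> {1..r}"
      and root': "\<And>X j. X \<subseteq> E' \<Longrightarrow> linked X v \<Longrightarrow> j \<in> {1..r} \<Longrightarrow> surplus r f' X j \<le> \<psi>' (q (\<sigma> j))"
      and all': "\<And>X j. X \<subseteq> E' \<Longrightarrow> connected_edges X \<Longrightarrow> j \<in> {1..r} \<Longrightarrow> surplus r f' X j \<le> bound r m'"
      using col'[OF \<sigma>'[unfolded I_def]] by auto
    define g where "g e = (if e \<in> E then f e else f' e)" for e
    have same: "surplus r g X j = surplus r f X j" if "X \<subseteq> E" for X j
      using that by (intro surplus_cong) (auto simp: g_def)
    have same': "surplus r g X j = surplus r f' X j" if "X \<subseteq> E'" for X j
      using that merge.hyps(5) by (intro surplus_cong) (auto simp: g_def)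
    have fin: "finite E" "finite E'" using merge.hyps(1,2) by (auto intro: rooted_tree_finite)
    have rt: "surplus r g X j \<le> \<phi> (\<tau> j)"
      if X: "X \<subseteq> E \<union> E'" "linked X v" and j: "j \<in> {1..r}" for X j
    proof -
      have "surplus r g X j = surplus r g (X \<inter> E \<union> X \<inter> E') j"
        using X(1) by (intro arg_cong[where f = "\<lambda>X. surplus r g X j"]) blast
      also have "\<dots> = surplus r g (X \<inter> E) j + surplus r g (X \<inter> E') j"
        unfolding surplus_def using fin merge.hyps(5) by (intro sum.union_disjoint) auto
      also have "\<dots> = surplus r f (X \<inter> E) j + surplus r f' (X \<inter> E') j"
        by (simp add: same same')
      also have "\<dots> \<le> \<psi> (\<sigma> j) + \<psi>' (q (\<sigma> j))"
        using linked_restrict[OF X(2,1) merge.hyps(6)] linked_restrict[of X v E' E] X merge.hyps(6) j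
        by (intro add_mono root root') (auto simp: Un_commute Int_commute)
      finally show ?thesis using sum[OF j] by simp
    qed
    have al: "surplus r g X j \<le> bound r (m + m')"
      if X: "X \<subseteq> E \<union> E'" "connected_edges X" and j: "j \<in> {1..r}" for X j
    proof (cases "v \<in> \<Union>X")
      case True
      then have "linked X v" using X(2) by (auto simp: connected_edges_def)
      then have "surplus r g X j \<le> \<phi> (\<tau> j)" using rt X(1) j by blast
      also have "\<dots> \<le> bound r (m + m')" using profile_le_bound[OF \<phi>] bij_betwE[OF \<tau>'] j by auto
      finally show ?thesis .
    next
      case False
      have "{} \<notin> X" using X(1) rooted_tree_no_empty[OF merge.hyps(1)] rooted_tree_no_empty[OF merge.hyps(2)] by auto
      then consider "X \<subseteq> E" | "X \<subseteq> E'"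
        using connected_edges_split[OF X(2,1) merge.hyps(6) False] by blast
      then show ?thesis
      proof cases
        case 1
        then have "surplus r g X j \<le> bound r m" using all X(2) j same by metis
        also have "\<dots> \<le> bound r (m + m')" using assms(1) by (intro bound_mono) auto
        finally show ?thesis .
      next
        case 2
        then have "surplus r g X j \<le> bound r m'" using all' X(2) j same' by metis
        also have "\<dots> \<le> bound r (m + m')" using assms(1) by (intro bound_mono) auto
        finally show ?thesis .
      qed
    qed
    have "g ` (E \<union> E') \<subseteq> {1..r}" using f f' by (auto simp: g_def)
    then show ?thesis using rt al by blast
  qed
  then show ?case using \<phi> by blast
qed


section \<open>Trees are rooted trees\<close>

lemma distinct_walk:
  assumes "(x, y) \<in> (adj (edges G))\<^sup>*" "y \<in> verts G" "\<Union>(edges G) \<subseteq> verts G"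
  shows "\<exists>p. walk G p \<and> distinct p \<and> hd p = x \<and> last p = y"
  using assms(1)
proof (induction rule: converse_rtrancl_induct)
  case base
  have "walk G [y]" using assms(2) by (simp add: walk_def)
  then show ?case by (intro exI[of _ "[y]"]) simp
next
  case (step x z)
  then obtain p where p: "walk G p" "distinct p" "hd p = z" "last p = y" by blast
  have xz: "{x, z} \<in> edges G" using step.hyps(1) by (simp add: adj_def)
  show ?case
  proof (cases "x \<in> set p")
    case True
    then obtain i where i: "i < length p" "p ! i = x" by (metis in_set_conv_nth)
    have "walk G (drop i p)"
      using p(1) i(1) set_drop_subset[of i p] unfolding walk_def by auto
    moreover have "hd (drop i p) = x" "last (drop i p) = y"
      using i p(4) by (simp_all add: hd_drop_conv_nth)
    ultimately show ?thesis using p(2) by (intro exI[of _ "drop i p"]) simp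
  next
    case False
    have "walk G (x # p)"
      unfolding walk_def
    proof (intro conjI allI impI)
      show "set (x # p) \<subseteq> verts G" using p(1) xz assms(3) by (auto simp: walk_def)
      fix i assume "Suc i < length (x # p)"
      then show "{(x # p) ! i, (x # p) ! Suc i} \<in> edges G"
        using p(1,3) xz by (cases i) (auto simp: walk_def hd_conv_nth)
    qed simp
    moreover have "p \<noteq> []" using p(1) by (simp add: walk_def)
    ultimately show ?thesis using False p by (intro exI[of _ "x # p"]) simp
  qed
qed

lemma walk_imp_adj:
  assumes "walk G p"
  shows "(hd p, last p) \<in> (adj (edges G))\<^sup>*"
proof -
  have "(p ! 0, p ! i) \<in> (adj (edges G))\<^sup>*" if "i < length p" for i
    using that
  proof (induction i)
    case (Suc i)
    then have "(p ! i, p ! Suc i) \<in> adj (edges G)" using assms by (simp add: walk_def adj_def)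
    then show ?case using Suc by (meson Suc_lessD rtrancl.rtrancl_into_rtrancl)
  qed simp
  moreover have "p \<noteq> []" using assms by (simp add: walk_def)
  ultimately show ?thesis by (simp add: hd_conv_nth last_conv_nth)
qed

lemma connected_graph_adj:
  "connected_graph G \<Longrightarrow> u \<in> verts G \<Longrightarrow> v \<in> verts G \<Longrightarrow> (u, v) \<in> (adj (edges G))\<^sup>*"
  unfolding connected_graph_def by (metis walk_imp_adj)

lemma connected_graphI:
  assumes "\<Union>(edges G) \<subseteq> verts G" "verts G \<noteq> {}"
    and "\<And>u v. u \<in> verts G \<Longrightarrow> v \<in> verts G \<Longrightarrow> (u, v) \<in> (adj (edges G))\<^sup>*"
  shows "connected_graph G"
  unfolding connected_graph_def using assms distinct_walk[of _ _ G] by metis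

lemma tree_connected_edges:
  assumes "S \<in> trees"
  shows "connected_edges (edges S)"
proof -
  have "graph S" "connected_graph S" using assms by (auto simp: trees_def)
  moreover from this have "\<Union>(edges S) \<subseteq> verts S" by (auto simp: graph_def)
  ultimately show ?thesis
    unfolding connected_edges_def linked_def using connected_graph_adj[of S] by blast
qed

lemma graph_finite_edges: "graph G \<Longrightarrow> finite (edges G)"
  unfolding graph_def by (metis Pow_iff finite_Pow_iff finite_subset subsetI)

text \<open>
  Take a maximal edge set of the tree that forms a rooted tree with root \<open>v\<close>. It spans, as otherwise an
  edge leaving it could be attached. It contains all edges, as a missing edge would close a cycle.
\<close>
lemma tree_is_rooted_tree:
  assumes "T \<in> trees" "v \<in> verts T"
  shows "\<exists>m. rooted_tree (edges T) v m"
proof -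
  have T: "graph T" "connected_graph T" "\<nexists>p. cycle T p" using assms(1) by (auto simp: trees_def)
  have inV: "\<Union>(edges T) \<subseteq> verts T" using T(1) by (auto simp: graph_def)
  define R where "R = {E. E \<subseteq> edges T \<and> (\<exists>m. rooted_tree E v m)}"
  have "finite R"
    using graph_finite_edges[OF T(1)] unfolding R_def by (simp add: finite_subset[of _ "Pow (edges T)"] Collect_mono_iff Pow_def)
  moreover have "{} \<in> R" unfolding R_def using rooted_tree.single[of v] by blast
  ultimately obtain E where E: "E \<in> R" and max: "\<And>E'. E' \<in> R \<Longrightarrow> E \<subseteq> E' \<Longrightarrow> E' = E"
    by (metis finite_has_maximal2)
  obtain m where m: "rooted_tree E v m" and sub: "E \<subseteq> edges T" using E by (auto simp: R_def)
  have closed: "z \<in> insert v (\<Union>E)" if yz: "{y, z} \<in> edges T" "y \<in> insert v (\<Union>E)" for y z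
  proof (rule ccontr)
    assume z: "z \<notin> insert v (\<Union>E)"
    then obtain m' where "rooted_tree (insert {y, z} E) v m'"
      using rooted_tree_add_edge[OF m yz(2)] by blast
    then have "insert {y, z} E \<in> R" using yz(1) sub by (auto simp: R_def)
    then have "insert {y, z} E = E" using max by blast
    then show False using z by blast
  qed
  have spanning: "x \<in> insert v (\<Union>E)" if "x \<in> verts T" for x
    using connected_graph_adj[OF T(2) assms(2) that] insertI1 closed by (rule adj_invariant)
  have "edges T \<subseteq> E"
  proof
    fix e assume e: "e \<in> edges T"
    show "e \<in> E"
    proof (rule ccontr)
      assume ne: "e \<notin> E"
      have "card e = 2" using T(1) e by (simp add: graph_def)
      then obtain a b where ab: "e = {a, b}" "a \<noteq> b" by (auto simp: card_2_iff)
      have av: "(x, v) \<in> (adj E)\<^sup>*" if "x \<in> {a, b}" for x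
      proof -
        have "x \<in> insert v (\<Union>E)" using spanning inV e ab that by blast
        then show ?thesis using rooted_tree_linked[OF m] by (auto simp: linked_def)
      qed
      have "(a, b) \<in> (adj E)\<^sup>*"
        using av[of a] adj_rtrancl_sym[OF av[of b]] by (simp add: rtrancl_trans)
      then obtain p where p: "walk (verts T, E) p" "distinct p" "hd p = a" "last p = b"
        using distinct_walk[of a b "(verts T, E)"] inV sub e ab by auto
      have "length p \<noteq> 0" using p(1) by (simp add: walk_def)
      moreover have "length p \<noteq> 1" using p ab(2) by (auto simp: length_Suc_conv)
      moreover have "length p \<noteq> 2"
      proof
        assume "length p = 2"
        then obtain x y where "p = [x, y]" by (auto simp: length_Suc_conv numeral_2_eq_2)
        then show False using p ab ne by (auto simp: walk_def)
      qed
      ultimately have "3 \<le> length p" by linarith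
      moreover have "walk T p" using p(1) sub by (auto simp: walk_def)
      moreover have "{last p, hd p} \<in> edges T" using p e ab by (simp add: insert_commute)
      ultimately have "cycle T p" using p(2) by (simp add: cycle_def)
      then show False using T(3) by blast
    qed
  qed
  then show ?thesis using m sub by auto
qed

lemma leaves_eq_tips:
  assumes "graph T"
  shows "leaves T - {v} = tips (edges T) v"
proof -
  have "x \<in> \<Union>(edges T)" if "card {e \<in> edges T. x \<in> e} = 1" for x
    using that by (auto simp: card_1_singleton_iff)
  then show ?thesis
    using assms unfolding leaves_def degree_def tips_def graph_def by auto
qed

section \<open>The upper bound\<close>

text \<open>The root has to be a leaf: only then does the tree have \<open>l - 1\<close> further leaves.\<close>
lemma tree_coloring:
  assumes T: "T \<in> trees" and r: "2 \<le> r" and l: "card (leaves T) = l"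
  shows "\<exists>f. f ` edges T \<subseteq> {1..r} \<and> (\<forall>S \<in> trees. subgraph S T \<longrightarrow>
           (\<forall>j \<in> {1..r}. surplus r f (edges S) j \<le> \<lceil>(real r - 1) * (real l / 2)\<rceil>))"
proof (cases "edges T = {}")
  case True
  then have "surplus r f (edges S) j = 0" if "subgraph S T" for f S j
    using that by (auto simp: subgraph_def surplus_def)
  moreover have "0 \<le> (real r - 1) * (real l / 2)" using r by simp
  then have "0 \<le> \<lceil>(real r - 1) * (real l / 2)\<rceil>" by linarith
  ultimately show ?thesis using True by auto
next
  case False
  have G: "graph T" "verts T \<noteq> {}" using T by (auto simp: trees_def connected_graph_def)
  have fin: "finite (leaves T)" using G(1) by (simp add: leaves_def graph_def)
  \<comment> \<open>Rooting at an arbitrary vertex shows that there is a leaf.\<close>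
  obtain v where "v \<in> verts T" using G(2) by blast
  then obtain m where m: "rooted_tree (edges T) v m" using tree_is_rooted_tree[OF T] by blast
  have "leaves T - {v} \<noteq> {}"
    using rooted_tree_tips[OF m] False unfolding leaves_eq_tips[OF G(1)] by auto
  then obtain w where w: "w \<in> leaves T" by blast
  then obtain k where k: "rooted_tree (edges T) w k"
    using tree_is_rooted_tree[OF T, of w] by (auto simp: leaves_def)
  have "k = card (leaves T - {w})"
    using rooted_tree_tips[OF k] False leaves_eq_tips[OF G(1)] by simp
  then have "l = k + 1" using w l fin by (metis card_Suc_Diff1 Suc_eq_plus1)
  then have bd: "bound r k = \<lceil>(real r - 1) * (real l / 2)\<rceil>" by (simp add: bound_def)
  have "bij_betw (\<lambda>j. int j - 1) {1..r} {0..<int r}"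
    by (rule bij_betw_byWitness[where f' = "\<lambda>x. nat (x + 1)"]) auto
  then obtain f where "f ` edges T \<subseteq> {1..r}"
    and "\<And>X j. X \<subseteq> edges T \<Longrightarrow> connected_edges X \<Longrightarrow> j \<in> {1..r} \<Longrightarrow> surplus r f X j \<le> bound r k"
    using rooted_tree_coloring[OF r k] by metis
  then show ?thesis using tree_connected_edges unfolding bd[symmetric] subgraph_def by blast
qed

section \<open>The lower bound\<close>

lemma sum_surplus:
  assumes "finite E" "f ` E \<subseteq> {1..r}"
  shows "(\<Sum>j\<in>{1..r}. surplus r f E j) = 0"
proof -
  have "(\<Sum>j\<in>{1..r}. if f e = j then int r - 1 else - 1) = 0" if "e \<in> E" for e
  proof -
    have "f e \<in> {1..r}" using assms(2) that by blast
    have "(\<Sum>j\<in>{1..r}. if f e = j then int r - 1 else - 1) = (\<Sum>j\<in>{1..r}. (if f e = j then int r else 0) - 1)"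
      by (rule sum.cong) auto
    also have "\<dots> = 0" using \<open>f e \<in> {1..r}\<close> by (simp add: sum_subtractf)
    finally show ?thesis .
  qed
  then show ?thesis unfolding surplus_def by (subst sum.swap) simp
qed

text \<open>Each edge of \<open>L\<close> is omitted for all colours but its own, and each omission saves a weight of \<open>-1\<close>.\<close>
lemma sum_surplus_pruned:
  assumes "finite E" "f ` E \<subseteq> {1..r}" "L \<subseteq> E"
  shows "(\<Sum>j\<in>{1..r}. surplus r f (E - {e \<in> L. f e \<noteq> j}) j) = (int r - 1) * int (card L)"
proof -
  have fin: "finite L" using assms(1,3) by (rule rev_finite_subset)
  have "surplus r f (E - {e \<in> L. f e \<noteq> j}) j = surplus r f E j + (\<Sum>e\<in>L. if f e \<noteq> j then 1 else 0)" for j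
  proof -
    have "surplus r f {e \<in> L. f e \<noteq> j} j = - int (card {e \<in> L. f e \<noteq> j})"
      unfolding surplus_def by simp
    moreover have "surplus r f E j
        = surplus r f (E - {e \<in> L. f e \<noteq> j}) j + surplus r f {e \<in> L. f e \<noteq> j} j"
      unfolding surplus_def using assms(1,3) by (intro sum.subset_diff) auto
    moreover have "(\<Sum>e\<in>L. if f e \<noteq> j then 1 else 0) = int (card {e \<in> L. f e \<noteq> j})"
      using fin by (simp add: sum.If_cases Int_def del: if_not_P)
    ultimately show ?thesis by linarith
  qed
  then have "(\<Sum>j\<in>{1..r}. surplus r f (E - {e \<in> L. f e \<noteq> j}) j)
      = (\<Sum>j\<in>{1..r}. \<Sum>e\<in>L. if f e \<noteq> j then 1 else 0)"
    using sum_surplus[OF assms(1,2)] by (simp add: sum.distrib)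
  also have "\<dots> = (\<Sum>e\<in>L. \<Sum>j\<in>{1..r}. if f e \<noteq> j then 1 else 0)" by (rule sum.swap)
  also have "\<dots> = (\<Sum>e\<in>L. int r - 1)"
  proof (rule sum.cong[OF refl])
    fix e assume "e \<in> L"
    then have fe: "f e \<in> {1..r}" using assms(2,3) by blast
    have "(\<Sum>j\<in>{1..r}. if f e \<noteq> j then 1 else 0) = (\<Sum>j\<in>{1..r}. 1 - (if f e = j then 1 else 0 :: int))"
      by (rule sum.cong) auto
    also have "\<dots> = int r - 1" using fe by (simp add: sum_subtractf)
    finally show "(\<Sum>j\<in>{1..r}. if f e \<noteq> j then 1 else 0) = int r - 1" .
  qed
  also have "\<dots> = (int r - 1) * int (card L)" by simp
  finally show ?thesis .
qed

lemma cycle_mono: "cycle S p \<Longrightarrow> verts S \<subseteq> verts G \<Longrightarrow> edges S \<subseteq> edges G \<Longrightarrow> cycle G p"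
  unfolding cycle_def walk_def by blast

text \<open>
  Sending every removed leaf to its neighbour retracts the tree onto what remains, so walks of the tree
  become walks that avoid \<open>L\<close>. The assumption that no edge joins two leaves ensures that these neighbours
  remain.
\<close>
lemma prune_leaves:
  assumes T: "T \<in> trees" and L: "L \<subseteq> leaves T"
    and sep: "\<And>e. e \<in> edges T \<Longrightarrow> \<not> e \<subseteq> leaves T" and ne: "verts T - L \<noteq> {}"
  shows "(verts T - L, {e \<in> edges T. e \<inter> L = {}}) \<in> trees"
proof -
  let ?X = "{e \<in> edges T. e \<inter> L = {}}" and ?S = "(verts T - L, {e \<in> edges T. e \<inter> L = {}})"
  have G: "graph T" "connected_graph T" "\<nexists>p. cycle T p" using T by (auto simp: trees_def)
  have "\<exists>y. \<forall>z. {x, z} \<in> edges T \<longleftrightarrow> z = y" if x: "x \<in> leaves T" for x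
  proof -
    obtain e where e: "{e \<in> edges T. x \<in> e} = {e}"
      using x by (auto simp: leaves_def degree_def card_1_singleton_iff)
    then have "e \<in> edges T" "x \<in> e" by blast+
    then have "card e = 2" using G(1) by (simp add: graph_def)
    then obtain y where y: "e = {x, y}" using \<open>x \<in> e\<close> by (auto simp: card_2_iff)
    have "z = y" if "{x, z} \<in> edges T" for z
    proof -
      have "{x, z} \<in> {e \<in> edges T. x \<in> e}" using that by simp
      then have "{x, z} = {x, y}" using e y by simp
      then show ?thesis by (auto simp: doubleton_eq_iff)
    qed
    then show ?thesis using \<open>e \<in> edges T\<close> y by blast
  qed
  then obtain n where n: "\<And>x z. x \<in> leaves T \<Longrightarrow> {x, z} \<in> edges T \<longleftrightarrow> z = n x" by metis
  \<comment> \<open>The retraction; an edge is mapped to an edge or collapsed to a vertex.\<close>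
  define g where "g x = (if x \<in> L then n x else x)" for x
  have step: "(g x, g y) \<in> (adj ?X)\<^sup>*" if xy: "{x, y} \<in> edges T" for x y
  proof -
    have yx: "{y, x} \<in> edges T" using xy by (simp add: insert_commute)
    have "\<not> (x \<in> L \<and> y \<in> L)" using sep[OF xy] L by blast
    then consider "x \<in> L" "y \<notin> L" | "x \<notin> L" "y \<in> L" | "x \<notin> L" "y \<notin> L" by blast
    then show ?thesis
    proof cases
      case 1
      then have "g x = g y" using n[of x y] L xy by (auto simp: g_def)
      then show ?thesis by simp
    next
      case 2
      then have "g x = g y" using n[of y x] L yx by (auto simp: g_def)
      then show ?thesis by simp
    next
      case 3
      then have "(g x, g y) \<in> adj ?X" using xy by (simp add: g_def adj_def)
      then show ?thesis by blast
    qed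
  qed
  have "(g x, g y) \<in> (adj ?X)\<^sup>*" if "(x, y) \<in> (adj (edges T))\<^sup>*" for x y
    using that
  proof (induction rule: rtrancl_induct)
    case (step y z)
    then show ?case using \<open>\<And>y x. {x, y} \<in> edges T \<Longrightarrow> (g x, g y) \<in> (adj ?X)\<^sup>*\<close>[of y z]
      by (auto simp: adj_def)
  qed simp
  then have "(x, y) \<in> (adj ?X)\<^sup>*" if "x \<in> verts T - L" "y \<in> verts T - L" for x y
    using connected_graph_adj[OF G(2), of x y] that by (fastforce simp: g_def)
  moreover have gS: "graph ?S" using G(1) by (auto simp: graph_def)
  ultimately have "connected_graph ?S"
    using ne by (intro connected_graphI) (auto simp: graph_def)
  moreover have "\<nexists>p. cycle ?S p" using G(3) cycle_mono[of ?S _ T] by auto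
  ultimately show ?thesis using gS by (simp add: trees_def)
qed

text \<open>The exception in \<open>prune_leaves\<close>: no edge leaves the end vertices of an edge between two leaves, so by
  connectivity the tree is that edge.\<close>
lemma leaf_edge_tree:
  assumes T: "T \<in> trees" and e: "e \<in> edges T" "e \<subseteq> leaves T"
  shows "edges T = {e}" "leaves T = e"
proof -
  have G: "graph T" "connected_graph T" using T by (auto simp: trees_def)
  have only: "e' = e" if "e' \<in> edges T" "x \<in> e'" "x \<in> e" for e' x
  proof -
    have "x \<in> leaves T" using that e by blast
    then obtain d where d: "{e \<in> edges T. x \<in> e} = {d}"
      by (auto simp: leaves_def degree_def card_1_singleton_iff)
    have "e' \<in> {e \<in> edges T. x \<in> e}" "e \<in> {e \<in> edges T. x \<in> e}" using that e by simp_all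
    then show ?thesis using d by simp
  qed
  have ce: "card e = 2" "e \<subseteq> verts T" using G(1) e by (auto simp: graph_def)
  then obtain a where a: "a \<in> e" by fastforce
  have V: "verts T \<subseteq> e"
  proof
    fix x assume "x \<in> verts T"
    with a ce have "(a, x) \<in> (adj (edges T))\<^sup>*" using connected_graph_adj[OF G(2)] by blast
    then show "x \<in> e" using a by (rule adj_invariant) (use only in blast)
  qed
  then show "leaves T = e" using e by (auto simp: leaves_def)
  have "e' = e" if e': "e' \<in> edges T" for e'
  proof -
    have "card e' = 2" "e' \<subseteq> e" using G(1) e' V by (auto simp: graph_def)
    then obtain x where "x \<in> e'" by fastforce
    then show ?thesis using only e' \<open>e' \<subseteq> e\<close> by blast
  qed
  then show "edges T = {e}" using e by blast
qed

text \<open>The largest of the \<open>r\<close> pruned surpluses is at least their average. Multiplying by \<open>r\<close> keeps the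
  statement in the integers.\<close>
lemma exists_large_surplus:
  assumes T: "T \<in> trees" and r: "2 \<le> r" and f: "f ` edges T \<subseteq> {1..r}"
    and l: "card (leaves T) = l"
  shows "\<exists>S \<in> trees. subgraph S T \<and> (\<exists>j \<in> {1..r}. (int r - 1) * int l \<le> int r * surplus r f (edges S) j)"
proof (cases "\<exists>e \<in> edges T. e \<subseteq> leaves T")
  case True
  then obtain e where e: "e \<in> edges T" "e \<subseteq> leaves T" by blast
  have E: "edges T = {e}" "leaves T = e" using leaf_edge_tree[OF T e] .
  have G: "graph T" using T by (simp add: trees_def)
  have "l = 2" using E l e G by (auto simp: graph_def)
  moreover have "surplus r f (edges T) (f e) = int r - 1" using E by (simp add: surplus_def)
  moreover have "(int r - 1) * 2 \<le> int r * (int r - 1)"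
    using r by (subst mult.commute) (intro mult_right_mono, auto)
  moreover have "f e \<in> {1..r}" "subgraph T T" using f e G by (auto simp: subgraph_def)
  ultimately show ?thesis using T by (intro bexI[of _ T] conjI bexI[of _ "f e"]) simp_all
next
  case False
  have G: "graph T" "verts T \<noteq> {}" using T by (auto simp: trees_def connected_graph_def)
  have finE: "finite (edges T)" using G(1) by (rule graph_finite_edges)
  have "\<exists>d. {e \<in> edges T. x \<in> e} = {d}" if "x \<in> leaves T" for x
    using that by (auto simp: leaves_def degree_def card_1_singleton_iff)
  then obtain d where d: "\<And>x. x \<in> leaves T \<Longrightarrow> {e \<in> edges T. x \<in> e} = {d x}" by metis
  have d_iff: "x \<in> e \<longleftrightarrow> e = d x" if "x \<in> leaves T" "e \<in> edges T" for x e
    using d[OF that(1)] that(2) by blast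
  have dE: "d x \<in> edges T" if "x \<in> leaves T" for x using d[OF that] by blast
  \<comment> \<open>No edge joins two leaves, so there are as many leaf edges as leaves.\<close>
  have inj: "inj_on d (leaves T)"
  proof (rule inj_onI, rule ccontr)
    fix x y assume xy: "x \<in> leaves T" "y \<in> leaves T" "d x = d y" "x \<noteq> y"
    have "card (d x) = 2" using dE[OF xy(1)] G(1) by (simp add: graph_def)
    moreover have "x \<in> d x" "y \<in> d x" using d_iff dE xy by metis+
    ultimately have "d x = {x, y}" using xy(4) by (auto simp: card_2_iff)
    then show False using False dE[OF xy(1)] xy(1,2) by (metis empty_subsetI insert_subset)
  qed
  define L where "L = d ` leaves T"
  have cardL: "card L = l" unfolding L_def using card_image[OF inj] l by simp
  have sum: "(\<Sum>j\<in>{1..r}. surplus r f (edges T - {e \<in> L. f e \<noteq> j}) j) = (int r - 1) * int l"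
    using sum_surplus_pruned[OF finE f, of L] dE cardL by (auto simp: L_def)
  have "\<exists>j \<in> {1..r}. (int r - 1) * int l \<le> int r * surplus r f (edges T - {e \<in> L. f e \<noteq> j}) j"
  proof (rule ccontr)
    assume "\<not> ?thesis"
    then have "(\<Sum>j\<in>{1..r}. int r * surplus r f (edges T - {e \<in> L. f e \<noteq> j}) j)
        < (\<Sum>j\<in>{1..r}. (int r - 1) * int l)"
      using r by (intro sum_strict_mono) (auto simp: not_le)
    then show False using sum by (simp add: sum_distrib_left[symmetric])
  qed
  then obtain j where j: "j \<in> {1..r}"
    and big: "(int r - 1) * int l \<le> int r * surplus r f (edges T - {e \<in> L. f e \<noteq> j}) j" by blast
  define W where "W = {x \<in> leaves T. f (d x) \<noteq> j}"
  let ?S = "(verts T - W, {e \<in> edges T. e \<inter> W = {}})"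
  have edges_eq: "edges T - {e \<in> L. f e \<noteq> j} = {e \<in> edges T. e \<inter> W = {}}"
    using d_iff unfolding L_def W_def by blast
  have "verts T - W \<noteq> {}"
  proof
    assume "verts T - W = {}"
    then have "verts T \<subseteq> leaves T" by (auto simp: W_def)
    moreover from this obtain x where "x \<in> leaves T" using G(2) by blast
    ultimately show False using False dE G(1) by (force simp: graph_def)
  qed
  then have "?S \<in> trees" using T False by (intro prune_leaves) (auto simp: W_def)
  moreover from this have "subgraph ?S T" using G(1) by (auto simp: subgraph_def trees_def)
  ultimately show ?thesis using j big edges_eq by (intro bexI[of _ ?S]) auto
qed

section \<open>The discrepancy\<close>

text \<open>The minimum and the maxima range over finite nonempty sets; colourings need not be extensional here,
  as only their values on edges matter.\<close>
lemma discrepancy_bounds: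
  assumes G: "graph G" and r: "1 \<le> r" and ne: "\<exists>S \<in> \<F>. subgraph S G"
  shows "(\<And>f. f ` edges G \<subseteq> {1..r} \<Longrightarrow>
            \<exists>S \<in> \<F>. subgraph S G \<and> (\<exists>j \<in> {1..r}. c \<le> surplus r f (edges S) j)) \<Longrightarrow>
          c \<le> discrepancy r G \<F>"
    and "(\<exists>f. f ` edges G \<subseteq> {1..r} \<and>
            (\<forall>S \<in> \<F>. subgraph S G \<longrightarrow> (\<forall>j \<in> {1..r}. surplus r f (edges S) j \<le> c))) \<Longrightarrow>
          discrepancy r G \<F> \<le> c"
proof -
  define A where "A = {S \<in> \<F>. subgraph S G}"
  define C where "C = edges G \<rightarrow>\<^sub>E {1..r}"
  define D where "D f = Max ((\<lambda>S. Max (surplus r f (edges S) ` {1..r})) ` A)" for f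
  have finE: "finite (edges G)" using G by (rule graph_finite_edges)
  have "A \<subseteq> Pow (verts G) \<times> Pow (edges G)" by (auto simp: A_def subgraph_def)
  then have finA: "finite A"
    using finE G by (rule_tac finite_subset) (auto simp: graph_def)
  have neA: "A \<noteq> {}" using ne by (auto simp: A_def)
  have finC: "finite C" unfolding C_def using finE by (intro finite_PiE) auto
  have neC: "C \<noteq> {}" unfolding C_def using r by (auto simp: PiE_eq_empty_iff)
  have "int r * int (card {e \<in> edges S. f e = j}) - int (card (edges S)) = surplus r f (edges S) j"
    if "S \<in> A" for f S j
  proof -
    have "finite (edges S)" using that by (auto simp: A_def subgraph_def intro: graph_finite_edges)
    then show ?thesis by (simp add: surplus_eq)
  qed
  then have disc: "discrepancy r G \<F> = Min (D ` C)"
    unfolding discrepancy_def D_def A_def[symmetric] C_def[symmetric] 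
    by (intro arg_cong[where f = Min] image_cong refl arg_cong[where f = Max]) (simp only:)
  have le_D: "x \<le> D f \<longleftrightarrow> (\<exists>S\<in>A. \<exists>j\<in>{1..r}. x \<le> surplus r f (edges S) j)" for x f
    unfolding D_def using finA neA r by (simp add: Max_ge_iff)
  have D_le: "D f \<le> x \<longleftrightarrow> (\<forall>S\<in>A. \<forall>j\<in>{1..r}. surplus r f (edges S) j \<le> x)" for x f
    unfolding D_def using finA neA r by (simp add: Max_le_iff)
  show "c \<le> discrepancy r G \<F>" if *: "\<And>f. f ` edges G \<subseteq> {1..r} \<Longrightarrow>
            \<exists>S \<in> \<F>. subgraph S G \<and> (\<exists>j \<in> {1..r}. c \<le> surplus r f (edges S) j)"
  proof -
    have "c \<le> D f" if "f \<in> C" for f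
    proof -
      have "f ` edges G \<subseteq> {1..r}" using that by (auto simp: C_def)
      from *[OF this] show ?thesis unfolding le_D A_def by blast
    qed
    then show ?thesis unfolding disc using finC neC by simp
  qed
  show "discrepancy r G \<F> \<le> c" if **: "\<exists>f. f ` edges G \<subseteq> {1..r} \<and>
            (\<forall>S \<in> \<F>. subgraph S G \<longrightarrow> (\<forall>j \<in> {1..r}. surplus r f (edges S) j \<le> c))"
  proof -
    obtain f where f: "f ` edges G \<subseteq> {1..r}"
      and le: "\<forall>S \<in> \<F>. subgraph S G \<longrightarrow> (\<forall>j \<in> {1..r}. surplus r f (edges S) j \<le> c)"
      using ** by (elim exE conjE)
    let ?g = "restrict f (edges G)"
    have g: "?g \<in> C" using f by (auto simp: C_def)
    have "surplus r ?g (edges S) j = surplus r f (edges S) j" if "S \<in> A" for S j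
      using that by (intro surplus_cong) (auto simp: A_def subgraph_def)
    then have "D ?g \<le> c" using le unfolding D_le by (simp add: A_def)
    then show ?thesis unfolding disc using finC g by (meson Min_le finite_imageI imageI order_trans)
  qed
qed

theorem theorem1:
  fixes T :: "'a graph" and l :: nat
  assumes "T \<in> trees" and "card (leaves T) = l"
  shows "(\<forall>r::nat. r \<ge> 2 \<longrightarrow>
            \<lceil>(real r - 1) * (real l / real r)\<rceil> \<le> discrepancy r T trees \<and>
            discrepancy r T trees \<le> \<lceil>(real r - 1) * (real l / 2)\<rceil>)
         \<and> discrepancy 2 T trees = \<lceil>real l / 2\<rceil>"
proof -
  have G: "graph T" using assms(1) by (simp add: trees_def)
  then have ne: "\<exists>S \<in> trees. subgraph S T" using assms(1) by (auto simp: subgraph_def)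
  have bounds: "\<lceil>(real r - 1) * (real l / real r)\<rceil> \<le> discrepancy r T trees \<and>
      discrepancy r T trees \<le> \<lceil>(real r - 1) * (real l / 2)\<rceil>" if r: "2 \<le> r" for r
  proof
    have r1: "1 \<le> r" using r by simp
    show "discrepancy r T trees \<le> \<lceil>(real r - 1) * (real l / 2)\<rceil>"
      using discrepancy_bounds(2)[OF G r1 ne] tree_coloring[OF assms(1) r assms(2)] .
    show "\<lceil>(real r - 1) * (real l / real r)\<rceil> \<le> discrepancy r T trees"
    proof (rule discrepancy_bounds(1)[OF G r1 ne])
      fix f assume f: "f ` edges T \<subseteq> {1..r}"
      obtain S j where S: "S \<in> trees" "subgraph S T" "j \<in> {1..r}"
        and le: "(int r - 1) * int l \<le> int r * surplus r f (edges S) j"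
        using exists_large_surplus[OF assms(1) r f assms(2)] by blast
      have "real_of_int ((int r - 1) * int l) \<le> real_of_int (int r * surplus r f (edges S) j)"
        using le by (simp only: of_int_le_iff)
      then have "(real r - 1) * (real l / real r) \<le> real_of_int (surplus r f (edges S) j)"
        using r by (simp add: field_simps)
      then have "\<lceil>(real r - 1) * (real l / real r)\<rceil> \<le> surplus r f (edges S) j"
        by (simp add: ceiling_le_iff)
      then show "\<exists>S \<in> trees. subgraph S T \<and>
          (\<exists>j \<in> {1..r}. \<lceil>(real r - 1) * (real l / real r)\<rceil> \<le> surplus r f (edges S) j)"
        using S by blast
    qed
  qed
  moreover from bounds[of 2] have "discrepancy 2 T trees = \<lceil>real l / 2\<rceil>" by simp
  ultimately show ?thesis by blast
qed

end
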